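(* Let $P\subseteq\mathbb{C}$ be a finite pattern with $|P|\ge3$ which is cross-algebraic, and let $m=m(n)\geq n^{\alpha}$ for some fixed $0<\alpha<1$. Then there is $c_1=c_1(P,\alpha)>0$ such that \[ S_P(n,m)\geq c_1 n^{2}\quad\text{for every } n\geq|P|. \]
   Context: The cross-ratio of a 4-tuple $(u,v,w,z)$ of complex numbers is $\frac{(w-u)(z-v)}{(z-u)(w-v)}$. A pattern $P$ is cross-algebraic if the cross-ratio of every 4-tuple of distinct points of $P$ is an algebraic number. Sets $A,B\subseteq\mathbb{C}$ are similar if $B=zA+w$ for some $z,w\in\mathbb{C}$, $z\neq0$. $S_P(Q)$ is the number of subsets of $Q$ similar to $P$. $S_P(n,m)$ is the maximum of $S_P(Q)$ over all $n$-point sets $Q\subseteq\mathbb{C}$ with no $m$ collinear points.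
   Formalization: The bound is proved for those n≥|P| for which P itself has no m(n) collinear points; otherwise no admissible Q contains a copy of P and the claim fails (e.g. P={0,1,2}, α=1/2, n=m(n)=3 gives S_P(3,3)=0). *)

theory Defs
  imports "HOL-Analysis.Analysis" "HOL-Computational_Algebra.Polynomial"
begin

definition cross_ratio :: "complex \<Rightarrow> complex \<Rightarrow> complex \<Rightarrow> complex \<Rightarrow> complex" where
  "cross_ratio u v w z = ((w - u) * (z - v)) / ((z - u) * (w - v))"

definition cross_algebraic :: "complex set \<Rightarrow> bool" where
  "cross_algebraic P \<longleftrightarrow>
     (\<forall>u\<in>P. \<forall>v\<in>P. \<forall>w\<in>P. \<forall>z\<in>P. distinct [u, v, w, z] \<longrightarrow> algebraic (cross_ratio u v w z))"

definition similar_sets :: "complex set \<Rightarrow> complex set \<Rightarrow> bool" where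
  "similar_sets A B \<longleftrightarrow> (\<exists>z w. z \<noteq> 0 \<and> B = (\<lambda>a. z * a + w) ` A)"

definition num_similar_copies :: "complex set \<Rightarrow> complex set \<Rightarrow> nat" where
  "num_similar_copies P Q = card {T. T \<subseteq> Q \<and> similar_sets P T}"

text \<open>Used for finite \<open>Q\<close> only. For \<open>m \<le> 2\<close> no set with at least two points satisfies this,
  since at most two points are always collinear.\<close>

definition no_collinear :: "nat \<Rightarrow> complex set \<Rightarrow> bool" where
  "no_collinear m Q \<longleftrightarrow> \<not> (\<exists>T. T \<subseteq> Q \<and> card T = m \<and> collinear T)"

text \<open>This is \<open>S\<^sub>P(n,m)\<close>. Each \<open>num_similar_copies P Q\<close> is at most \<open>2 ^ n\<close>, so the maximum is over
  a finite set of naturals. That set is empty if \<open>n \<ge> 2\<close> and \<open>m \<le> 2\<close>, and \<open>Max\<close> is then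
  unspecified.\<close>

definition max_similar_copies :: "complex set \<Rightarrow> nat \<Rightarrow> nat \<Rightarrow> nat" where
  "max_similar_copies P n m =
     Max {num_similar_copies P Q | Q. finite Q \<and> card Q = n \<and> no_collinear m Q}"

end

theory Submission
  imports Defs
begin

text \<open>Fix three points \<open>a\<close>, \<open>b\<close>, \<open>c\<close> of \<open>P\<close>. The affine map sending \<open>a\<close> to \<open>(c - a) i\<close> and \<open>b\<close> to
  \<open>(c - b) j\<close> sends each \<open>p \<in> P\<close> to \<open>w p (\<mu> p i + \<nu> p j)\<close>, where for \<open>p \<noteq> a\<close> the quotient \<open>\<mu> p / \<nu> p\<close> is, up to sign, a cross-ratio,
  and \<open>\<mu> p\<close>, \<open>\<nu> p\<close> can be taken to be algebraic integers. They preserve a finitely generated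
  additive group; let \<open>B N\<close> be the set of combinations of its generators with coefficients
  bounded by \<open>N\<close>. If \<open>i\<close> and \<open>j\<close> range over the sums \<open>b 0 + b 1 \<zeta> + \<dots> + b (K - 1) \<zeta> ^ (K - 1)\<close> with
  \<open>b k \<in> B N\<close>, all the images lie in \<open>card P\<close> scaled copies of the same set of sums over \<open>B (C N)\<close>,
  which has at most a constant times as many elements; this gives quadratically many copies.
  For generic \<open>\<zeta>\<close> the products \<open>\<zeta> ^ k * cnj \<zeta> ^ l\<close> satisfy no nontrivial linear relation with the
  coefficients that occur, so a point on a line through two given points of such a set is determined by a
  single coordinate \<open>b l\<close>. Hence a line contains only about the \<open>K\<close>-th root of the number of all points, and
  \<open>K \<ge> 2 / \<alpha>\<close> suffices. Points in general position are added to reach exactly \<open>n\<close> points.\<close>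

section \<open>Lattices stable under algebraic integers\<close>

text \<open>If \<open>p\<close> has degree \<open>d\<close> and leading coefficient
  \<open>k\<close>, then \<open>k ^ (d - 1) * p(x)\<close> is a monic integer polynomial in
  \<open>k * x\<close>.\<close>

lemma algebraic_mult_algebraic_int:
  fixes x :: complex
  assumes "algebraic x"
  obtains k :: int where "k \<noteq> 0" "algebraic_int (of_int k * x)"
proof -
  obtain p :: "int poly" where p: "poly (map_poly of_int p) x = 0" "p \<noteq> 0"
    using assms by (auto elim: algebraicE')
  define d where "d = degree p"
  define k where "k = lead_coeff p"
  have "d > 0"
  proof (rule ccontr)
    assume "\<not> d > 0"
    then have "degree p = 0" by (simp add: d_def)
    then obtain c where "p = [:c:]" by (rule degree_eq_zeroE)
    with p show False by (auto simp: map_poly_pCons)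
  qed
  \<comment> \<open>The top coefficient is set to 1 separately: for \<open>i = d\<close> the
    truncated exponent \<open>d - 1 - i\<close> would be 0 and leave \<open>k\<close>.\<close>
  define c where "c i = (if i = d then 1 else k ^ (d - 1 - i) * coeff p i)" for i
  define q where "q = (\<Sum>i\<le>d. monom (c i) i)"
  have coeff_q: "coeff q i = (if i \<le> d then c i else 0)" for i
    by (simp add: q_def coeff_sum sum.delta')
  have "degree q = d"
    by (intro antisym degree_le le_degree) (auto simp: coeff_q c_def)
  then have lead: "lead_coeff q = 1"
    by (simp add: coeff_q c_def)
  have c_eq: "of_int (c i) * (of_int k * x) ^ i = of_int k ^ (d - 1) * (of_int (coeff p i) * x ^ i)" if "i \<le> d" for i
  proof (cases "i = d")
    case True
    then show ?thesis using \<open>d > 0\<close>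
      by (cases d) (auto simp: c_def k_def d_def power_mult_distrib mult_ac)
  next
    case False
    then have "d - 1 = (d - 1 - i) + i" using that by linarith
    then have "(of_int k :: complex) ^ (d - 1) = of_int k ^ (d - 1 - i) * of_int k ^ i"
      by (metis power_add)
    then show ?thesis using False
      by (simp add: c_def power_mult_distrib mult_ac)
  qed
  have "poly (map_poly of_int q) (of_int k * x) = (\<Sum>i\<le>d. of_int (c i) * (of_int k * x) ^ i)"
    using \<open>degree q = d\<close> by (simp add: poly_altdef coeff_map_poly degree_map_poly coeff_q)
  also have "\<dots> = of_int k ^ (d - 1) * (\<Sum>i\<le>d. of_int (coeff p i) * x ^ i)"
    by (simp add: c_eq sum_distrib_left)
  also have "(\<Sum>i\<le>d. of_int (coeff p i) * x ^ i) = 0"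
    using p(1) by (simp add: poly_altdef coeff_map_poly degree_map_poly d_def)
  finally have "algebraic_int (of_int k * x)"
    using lead by (auto simp: algebraic_int_altdef_ipoly)
  moreover have "k \<noteq> 0" using p by (simp add: k_def)
  ultimately show ?thesis using that by blast
qed

text \<open>Makes \<open>int_module.span E\<close> the additive group generated by
  \<open>E\<close>.\<close>

interpretation int_module: module "\<lambda>(k::int) (x::complex). of_int k * x"
  by unfold_locales (auto simp: algebra_simps)

text \<open>The ring generated by finitely many algebraic integers is finitely generated as a group:
  adjoining \<open>\<mu>\<close> with a monic equation of degree \<open>d\<close> only requires
  multiplying the generators by the powers of \<open>\<mu>\<close> below \<open>d\<close>. The
  generator 1 later makes the boxes grow.\<close>

lemma algebraic_ints_stabilise_lattice:
  fixes S :: "complex set"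
  assumes "finite S" and "\<And>x. x \<in> S \<Longrightarrow> algebraic_int x"
  obtains E where "finite E" and "1 \<in> E" and "\<And>x e. x \<in> S \<Longrightarrow> e \<in> E \<Longrightarrow> x * e \<in> int_module.span E"
proof -
  have "\<exists>E. finite E \<and> 1 \<in> E \<and> (\<forall>x\<in>S. \<forall>e\<in>E. x * e \<in> int_module.span E)"
    using assms
  proof (induction S rule: finite_induct)
    case empty
    show ?case by (rule exI[of _ "{1}"]) auto
  next
    case (insert \<mu> S)
    then obtain E where E: "finite E" "1 \<in> E" "\<And>x e. x \<in> S \<Longrightarrow> e \<in> E \<Longrightarrow> x * e \<in> int_module.span E"
      by auto
    from insert.prems have "algebraic_int \<mu>" by simp
    then obtain p :: "complex poly" where p: "lead_coeff p = 1" "\<And>i. coeff p i \<in> \<int>" "poly p \<mu> = 0"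
      by (auto elim: algebraic_int.cases)
    define d where "d = degree p"
    define E' where "E' = (\<lambda>(e, a). e * \<mu> ^ a) ` (E \<times> {..<d})"
    have "d > 0"
    proof (rule ccontr)
      assume "\<not> d > 0"
      then have "degree p = 0" by (simp add: d_def)
      then obtain c where "p = [:c:]" by (rule degree_eq_zeroE)
      with p show False by simp
    qed
    have gen: "e * \<mu> ^ a \<in> int_module.span E'" if "e \<in> E" "a < d" for e a
      using that unfolding E'_def by (intro int_module.span_base) force
    have top: "e * \<mu> ^ d \<in> int_module.span E'" if "e \<in> E" for e
    proof -
      have "\<exists>f. \<forall>i. coeff p i = of_int (f i)"
        using p(2) by (intro choice) (auto elim: Ints_cases)
      then obtain f where f: "\<And>i. coeff p i = of_int (f i)"
        by blast
      have "0 = (\<Sum>i\<le>d. coeff p i * \<mu> ^ i)"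
        using p(3) by (simp add: poly_altdef d_def)
      also have "\<dots> = (\<Sum>i<d. coeff p i * \<mu> ^ i) + \<mu> ^ d"
        using p(1) by (simp add: d_def flip: lessThan_Suc_atMost)
      finally have "\<mu> ^ d = - (\<Sum>i<d. coeff p i * \<mu> ^ i)"
        by (simp add: eq_neg_iff_add_eq_0 add.commute)
      then have "e * \<mu> ^ d = - (\<Sum>i<d. of_int (f i) * (e * \<mu> ^ i))"
        by (simp add: f sum_distrib_left mult_ac)
      also have "\<dots> \<in> int_module.span E'"
        using that by (intro int_module.span_neg int_module.span_sum int_module.span_scale gen) auto
      finally show ?thesis .
    qed
    \<comment> \<open>Previously treated elements stay stabilisers because
      \<open>x * (e * \<mu> ^ a) = (x * e) * \<mu> ^ a\<close>.\<close>
    have lift: "x * \<mu> ^ a \<in> int_module.span E'" if "x \<in> int_module.span E" and a: "a < d" for x a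
      using that(1)
    proof (induction rule: int_module.span_induct_alt)
      case base
      show ?case by (simp add: int_module.span_zero)
    next
      case (step k e y)
      have "(of_int k * e + y) * \<mu> ^ a = of_int k * (e * \<mu> ^ a) + y * \<mu> ^ a"
        by (simp add: algebra_simps)
      also have "\<dots> \<in> int_module.span E'"
        using gen[OF step(1) a] step(2) by (intro int_module.span_add int_module.span_scale)
      finally show ?case .
    qed
    have "x * e' \<in> int_module.span E'" if x: "x \<in> insert \<mu> S" and e': "e' \<in> E'" for x e'
    proof -
      obtain e a where e: "e \<in> E" "a < d" "e' = e * \<mu> ^ a"
        using e' by (auto simp: E'_def)
      show ?thesis
      proof (cases "x = \<mu>")
        case True
        then have "x * e' = e * \<mu> ^ Suc a"
          by (simp add: e)
        moreover have "Suc a < d \<or> Suc a = d" using e by linarith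
        ultimately show ?thesis using gen top e(1) by metis
      next
        case False
        then have "x * e \<in> int_module.span E" using x E e by auto
        from lift[OF this e(2)] show ?thesis by (simp add: e mult_ac)
      qed
    qed
    moreover have "finite E'" using E(1) by (simp add: E'_def)
    moreover have "1 \<in> E'"
      unfolding E'_def using E(2) \<open>d > 0\<close> by (intro image_eqI[of _ _ "(1, 0)"]) auto
    ultimately show ?case by blast
  qed
  then show ?thesis using that by blast
qed

section \<open>Boxes of bounded integer combinations\<close>

text \<open>The elements of \<open>E\<close> need not be linearly independent over the integers: only the doubling
  bound \<open>card_lattice_box_mult_le\<close> matters below, not the growth rate in \<open>N\<close>.\<close>

definition lattice_box :: "complex set \<Rightarrow> nat \<Rightarrow> complex set" where
  "lattice_box E N = (\<lambda>f. \<Sum>e\<in>E. of_int (f e) * e) ` {f. \<forall>e\<in>E. \<bar>f e\<bar> \<le> int N}"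

lemma lattice_boxI:
  "(\<And>e. e \<in> E \<Longrightarrow> \<bar>f e\<bar> \<le> int N) \<Longrightarrow> (\<Sum>e\<in>E. of_int (f e) * e) \<in> lattice_box E N"
  by (auto simp: lattice_box_def)

lemma lattice_box_iff:
  "x \<in> lattice_box E N \<longleftrightarrow> (\<exists>f. x = (\<Sum>e\<in>E. of_int (f e) * e) \<and> (\<forall>e\<in>E. \<bar>f e\<bar> \<le> int N))"
  by (auto simp: lattice_box_def)

lemma finite_lattice_box:
  assumes "finite E"
  shows "finite (lattice_box E N)"
proof -
  have "lattice_box E N \<subseteq> (\<lambda>f. \<Sum>e\<in>E. of_int (f e) * e) ` (E \<rightarrow>\<^sub>E {- int N..int N})"
  proof
    fix x assume "x \<in> lattice_box E N"
    then obtain f where f: "x = (\<Sum>e\<in>E. of_int (f e) * e)" "\<And>e. e \<in> E \<Longrightarrow> \<bar>f e\<bar> \<le> int N"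
      unfolding lattice_box_iff by blast
    then have "x = (\<Sum>e\<in>E. of_int (restrict f E e) * e)" "restrict f E \<in> E \<rightarrow>\<^sub>E {- int N..int N}"
      by (force simp: abs_le_iff intro: sum.cong)+
    then show "x \<in> (\<lambda>f. \<Sum>e\<in>E. of_int (f e) * e) ` (E \<rightarrow>\<^sub>E {- int N..int N})"
      by blast
  qed
  then show ?thesis
    using assms by (meson finite_PiE finite_atLeastAtMost_int finite_imageI finite_subset)
qed

lemma lattice_box_add:
  assumes "x \<in> lattice_box E M" "y \<in> lattice_box E N"
  shows "x + y \<in> lattice_box E (M + N)"
proof -
  obtain f g where f: "x = (\<Sum>e\<in>E. of_int (f e) * e)" "\<And>e. e \<in> E \<Longrightarrow> \<bar>f e\<bar> \<le> int M"
    and g: "y = (\<Sum>e\<in>E. of_int (g e) * e)" "\<And>e. e \<in> E \<Longrightarrow> \<bar>g e\<bar> \<le> int N"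
    using assms unfolding lattice_box_iff by blast
  have "x + y = (\<Sum>e\<in>E. of_int (f e + g e) * e)"
    by (simp add: f g algebra_simps sum.distrib)
  also have "\<dots> \<in> lattice_box E (M + N)"
    using f(2) g(2) by (intro lattice_boxI) (smt (verit) of_nat_add)
  finally show ?thesis .
qed

lemma lattice_box_scale:
  assumes "x \<in> lattice_box E M" "\<bar>k\<bar> \<le> int N"
  shows "of_int k * x \<in> lattice_box E (N * M)"
proof -
  obtain f where f: "x = (\<Sum>e\<in>E. of_int (f e) * e)" "\<And>e. e \<in> E \<Longrightarrow> \<bar>f e\<bar> \<le> int M"
    using assms unfolding lattice_box_iff by blast
  have "of_int k * x = (\<Sum>e\<in>E. of_int (k * f e) * e)"
    by (simp add: f algebra_simps sum_distrib_left)
  also have "\<dots> \<in> lattice_box E (N * M)"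
    using f(2) assms(2) by (intro lattice_boxI) (auto simp: abs_mult intro!: mult_mono)
  finally show ?thesis .
qed

lemma lattice_box_mono:
  assumes "M \<le> N"
  shows "lattice_box E M \<subseteq> lattice_box E N"
  using assms by (force simp: lattice_box_def intro!: image_mono)

lemma zero_in_lattice_box: "0 \<in> lattice_box E N"
  using lattice_boxI[of E "\<lambda>_. 0" N] by simp

lemma lattice_box_sum:
  assumes "finite A" "\<And>i. i \<in> A \<Longrightarrow> x i \<in> lattice_box E (M i)"
  shows "(\<Sum>i\<in>A. x i) \<in> lattice_box E (\<Sum>i\<in>A. M i)"
  using assms by (induction A rule: finite_induct) (auto intro: lattice_box_add zero_in_lattice_box)

lemma span_lattice_box:
  assumes "finite E" "x \<in> int_module.span E"
  obtains N where "x \<in> lattice_box E N"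
proof -
  obtain f where f: "x = (\<Sum>e\<in>E. of_int (f e) * e)"
    using assms by (auto simp: int_module.span_finite)
  have "\<bar>f e\<bar> \<le> int (\<Sum>e\<in>E. nat \<bar>f e\<bar>)" if "e \<in> E" for e
    using member_le_sum[of e E "\<lambda>e. nat \<bar>f e\<bar>"] that assms(1) by linarith
  then show ?thesis using that f lattice_boxI by blast
qed

text \<open>The factor \<open>C\<close> does not depend on \<open>N\<close>: it is the sum of the
  box sizes needed for the finitely many products \<open>x * e\<close>.\<close>

lemma lattice_box_mult:
  assumes "finite E" and "\<And>e. e \<in> E \<Longrightarrow> x * e \<in> int_module.span E"
  obtains C where "\<And>N y. y \<in> lattice_box E N \<Longrightarrow> x * y \<in> lattice_box E (C * N)"
proof -
  have "\<exists>N. x * e \<in> lattice_box E N" if "e \<in> E" for e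
    using span_lattice_box[OF assms(1) assms(2)[OF that]] by blast
  then have "\<exists>M. \<forall>e\<in>E. x * e \<in> lattice_box E (M e)"
    by (intro bchoice) blast
  then obtain M where M: "\<And>e. e \<in> E \<Longrightarrow> x * e \<in> lattice_box E (M e)"
    by blast
  have "x * y \<in> lattice_box E ((\<Sum>e\<in>E. M e) * N)" if y: "y \<in> lattice_box E N" for N y
  proof -
    obtain f where f: "y = (\<Sum>e\<in>E. of_int (f e) * e)" "\<And>e. e \<in> E \<Longrightarrow> \<bar>f e\<bar> \<le> int N"
      using y unfolding lattice_box_iff by blast
    have "x * y = (\<Sum>e\<in>E. of_int (f e) * (x * e))"
      by (simp add: f sum_distrib_left mult_ac)
    also have "\<dots> \<in> lattice_box E (\<Sum>e\<in>E. N * M e)"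
      using f(2) M assms(1) by (intro lattice_box_sum lattice_box_scale) auto
    finally show ?thesis by (simp add: sum_distrib_left mult.commute)
  qed
  then show ?thesis using that by blast
qed

lemma card_lattice_box_mult_le:
  assumes "finite E" "N > 0"
  shows "card (lattice_box E (C * N)) \<le> card (lattice_box E C) * card (lattice_box E N)"
proof -
  \<comment> \<open>divide every coefficient by \<open>N\<close> with remainder\<close>
  have "lattice_box E (C * N) \<subseteq> (\<lambda>(u, v). of_nat N * u + v) ` (lattice_box E C \<times> lattice_box E N)"
  proof
    fix x assume "x \<in> lattice_box E (C * N)"
    then obtain f where f: "x = (\<Sum>e\<in>E. of_int (f e) * e)" "\<And>e. e \<in> E \<Longrightarrow> \<bar>f e\<bar> \<le> int (C * N)"
      unfolding lattice_box_iff by blast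
    define u where "u = (\<Sum>e\<in>E. of_int (f e div int N) * e)"
    define v where "v = (\<Sum>e\<in>E. of_int (f e mod int N) * e)"
    have "x = (\<Sum>e\<in>E. of_int (int N * (f e div int N) + f e mod int N) * e)"
      by (simp add: f)
    also have "\<dots> = of_nat N * u + v"
      unfolding u_def v_def of_int_add of_int_mult of_int_of_nat_eq
      by (simp add: algebra_simps sum.distrib sum_distrib_left)
    finally have "x = of_nat N * u + v" .
    moreover have "\<bar>f e div int N\<bar> \<le> int C" if "e \<in> E" for e
    proof -
      have "- (int C * int N) \<le> f e" "f e \<le> int C * int N"
        using f(2)[OF that] by auto
      then have "(- int C * int N) div int N \<le> f e div int N" "f e div int N \<le> (int C * int N) div int N"
        using assms(2) by (intro zdiv_mono1; simp)+
      then show ?thesis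
        using assms(2) by (simp del: mult_minus_left)
    qed
    then have "u \<in> lattice_box E C" unfolding u_def by (rule lattice_boxI)
    moreover have "v \<in> lattice_box E N" unfolding v_def
      using assms(2) by (intro lattice_boxI) (simp add: less_imp_le)
    ultimately show "x \<in> (\<lambda>(u, v). of_nat N * u + v) ` (lattice_box E C \<times> lattice_box E N)"
      by force
  qed
  then show ?thesis
    using assms(1) by (metis card_cartesian_product finite_SigmaI finite_lattice_box surj_card_le)
qed

lemma of_int_in_lattice_box:
  assumes "finite E" "1 \<in> E" "\<bar>k\<bar> \<le> int N"
  shows "of_int k \<in> lattice_box E N"
proof -
  have "(\<Sum>e\<in>E. of_int (if e = 1 then k else 0) * e) \<in> lattice_box E N"
    using assms(3) by (intro lattice_boxI) auto
  also have "(\<Sum>e\<in>E. of_int (if e = 1 then k else 0) * e) = (\<Sum>e\<in>E. if e = 1 then of_int k else 0)"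
    by (intro sum.cong) auto
  finally show ?thesis using assms by simp
qed

text \<open>Since 1 is a generator, the box contains the integers from 0 to \<open>N\<close>. This
  unboundedness lets a box size be matched to any large \<open>n\<close>.\<close>

lemma card_lattice_box_gt:
  assumes "finite E" "1 \<in> E"
  shows "card (lattice_box E N) > N"
proof -
  have "of_nat k \<in> lattice_box E N" if "k \<le> N" for k
    using of_int_in_lattice_box[OF assms, of "int k" N] that by simp
  then have "of_nat ` {..N} \<subseteq> lattice_box E N"
    by auto
  then have "card (of_nat ` {..N} :: complex set) \<le> card (lattice_box E N)"
    using finite_lattice_box[OF assms(1)] by (rule card_mono[rotated])
  then show ?thesis by (simp add: card_image inj_on_def)
qed

section \<open>Generic grids\<close>

text \<open>Only finitely many nonzero polynomials of degree below \<open>n\<close> have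
  coefficients in \<open>D\<close>, and together they have finitely many roots.\<close>

lemma exists_generic_point:
  fixes A D :: "'a::idom set"
  assumes "finite D" "infinite A"
  obtains x where "x \<in> A"
    "\<And>f. (\<And>i. i < n \<Longrightarrow> f i \<in> D) \<Longrightarrow> (\<Sum>i<n. f i * x ^ i) = 0 \<Longrightarrow> (\<forall>i<n. f i = 0)"
proof -
  define F where "F = {f \<in> {..<n} \<rightarrow>\<^sub>E D. \<exists>i<n. f i \<noteq> 0}"
  have "finite F"
    unfolding F_def using assms(1) by (intro finite_subset[OF _ finite_PiE[of "{..<n}" "\<lambda>_. D"]]) auto
  define p where "p f = (\<Sum>i<n. monom (f i) i)" for f :: "nat \<Rightarrow> 'a"
  have coeff_p: "coeff (p f) i = (if i < n then f i else 0)" for f i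
    by (simp add: p_def coeff_sum sum.delta')
  have "finite (\<Union>f\<in>F. {x. poly (p f) x = 0})"
  proof (intro finite_UN_I poly_roots_finite \<open>finite F\<close>)
    fix f assume "f \<in> F"
    then obtain i where "i < n" "f i \<noteq> 0" by (auto simp: F_def)
    then have "coeff (p f) i \<noteq> 0" by (simp add: coeff_p)
    then show "p f \<noteq> 0" by auto
  qed
  then have "\<not> A \<subseteq> (\<Union>f\<in>F. {x. poly (p f) x = 0})"
    using assms(2) finite_subset by blast
  then obtain x where x: "x \<in> A" "\<And>f. f \<in> F \<Longrightarrow> poly (p f) x \<noteq> 0"
    by blast
  have "\<forall>i<n. f i = 0" if D: "\<And>i. i < n \<Longrightarrow> f i \<in> D" and root: "(\<Sum>i<n. f i * x ^ i) = 0" for f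
  proof (rule ccontr)
    assume "\<not> (\<forall>i<n. f i = 0)"
    then have "restrict f {..<n} \<in> F"
      using D by (auto simp: F_def)
    moreover have "poly (p (restrict f {..<n})) x = (\<Sum>i<n. f i * x ^ i)"
      by (simp add: p_def poly_sum poly_monom)
    ultimately show False using x(2) root by metis
  qed
  with x(1) that show ?thesis by blast
qed

text \<open>The choice is made in two stages: first a real \<open>s\<close> generic over the
  coefficients, then \<open>\<zeta>\<close> on the circle of squared radius \<open>s\<close>,
  generic over the values at \<open>s\<close> of polynomials with those coefficients.\<close>

lemma exists_hermitian_generic:
  fixes D :: "complex set"
  assumes "finite D"
  obtains \<zeta> :: complex where
    "\<And>c. (\<And>k l. k < n \<Longrightarrow> l < n \<Longrightarrow> c k l \<in> D) \<Longrightarrow>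
       (\<Sum>k<n. \<Sum>l<n. c k l * \<zeta> ^ k * cnj \<zeta> ^ l) = 0 \<Longrightarrow> (\<forall>k<n. \<forall>l<n. c k l = 0)"
proof -
  \<comment> \<open>Zero is added because the coefficients are padded with zeros below.\<close>
  define D0 where "D0 = insert 0 D"
  have "finite D0" using assms by (simp add: D0_def)
  have "infinite (of_real ` {1..2::real} :: complex set)"
    by (simp add: finite_image_iff inj_on_def)
  then obtain s where s: "s \<in> (of_real ` {1..2::real} :: complex set)"
    and s_generic: "\<And>f. (\<And>i. i < n \<Longrightarrow> f i \<in> D0) \<Longrightarrow> (\<Sum>i<n. f i * s ^ i) = 0 \<Longrightarrow> (\<forall>i<n. f i = 0)"
    using exists_generic_point[OF \<open>finite D0\<close>, where n = n] by blast
  then obtain r where r: "s = of_real r" "r \<ge> 1" by auto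
  define D1 where "D1 = (\<lambda>f. \<Sum>i<n. f i * s ^ i) ` ({..<n} \<rightarrow>\<^sub>E D0)"
  have "finite D1"
    unfolding D1_def using \<open>finite D0\<close> by (intro finite_imageI finite_PiE) auto
  have D1I: "(\<Sum>i<n. f i * s ^ i) \<in> D1" if "\<And>i. i < n \<Longrightarrow> f i \<in> D0" for f
  proof -
    have "(\<Sum>i<n. restrict f {..<n} i * s ^ i) \<in> D1"
      unfolding D1_def using that by (intro imageI) (simp add: restrict_PiE_iff del: restrict_apply)
    then show ?thesis by simp
  qed
  \<comment> \<open>The bound \<open>r \<ge> 1\<close> keeps the square root real for
    \<open>t\<close> in the unit interval; the real part \<open>t\<close> makes the arc
    infinite.\<close>
  have "infinite ((\<lambda>t. Complex t (sqrt (r - t\<^sup>2))) ` {0..1})"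
    by (simp add: finite_image_iff inj_on_def)
  then obtain \<zeta> where \<zeta>: "\<zeta> \<in> (\<lambda>t. Complex t (sqrt (r - t\<^sup>2))) ` {0..1}"
    and \<zeta>_generic: "\<And>f. (\<And>i. i < 2 * n \<Longrightarrow> f i \<in> D1) \<Longrightarrow> (\<Sum>i<2 * n. f i * \<zeta> ^ i) = 0 \<Longrightarrow> (\<forall>i<2 * n. f i = 0)"
    using exists_generic_point[OF \<open>finite D1\<close>, where n = "2 * n"] by blast
  \<comment> \<open>On this circle \<open>cnj \<zeta> = s / \<zeta>\<close>, so multiplying the form by \<open>\<zeta> ^ n\<close> gives a polynomial in \<open>\<zeta>\<close>
    whose coefficients are polynomials in \<open>s\<close>.\<close>
  have "\<zeta> * cnj \<zeta> = s"
  proof -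
    obtain t where t: "0 \<le> t" "t \<le> 1" "\<zeta> = Complex t (sqrt (r - t\<^sup>2))"
      using \<zeta> by auto
    have "t\<^sup>2 \<le> 1" using t by (simp add: power_le_one)
    then show ?thesis
      using r t by (simp add: complex_mult_cnj)
  qed
  have "\<forall>k<n. \<forall>l<n. c k l = 0"
    if c: "\<And>k l. k < n \<Longrightarrow> l < n \<Longrightarrow> c k l \<in> D"
      and root: "(\<Sum>k<n. \<Sum>l<n. c k l * \<zeta> ^ k * cnj \<zeta> ^ l) = 0" for c
  proof -
    \<comment> \<open>\<open>g e l\<close> is the coefficient of \<open>s ^ l * \<zeta> ^ e\<close>
      after multiplication by \<open>\<zeta> ^ n\<close>: the term \<open>c k l\<close> lands at
      \<open>e = n + k - l\<close>, which is below \<open>2 * n\<close>.\<close>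
    define g where "g e l = (if n \<le> e + l \<and> e + l < 2 * n then c (e + l - n) l else 0)" for e l
    have g_D0: "g e l \<in> D0" if "l < n" for e l
      using that c by (auto simp: g_def D0_def)
    have shift: "(\<Sum>k<n. c k l * s ^ l * \<zeta> ^ (n + k - l)) = (\<Sum>e<2 * n. g e l * s ^ l * \<zeta> ^ e)" if "l < n" for l
    proof -
      have "(\<Sum>e<2 * n. g e l * s ^ l * \<zeta> ^ e) = (\<Sum>e\<in>{n - l..<2 * n - l}. g e l * s ^ l * \<zeta> ^ e)"
        using that by (intro sum.mono_neutral_right) (auto simp: g_def)
      also have "\<dots> = (\<Sum>k<n. c k l * s ^ l * \<zeta> ^ (n + k - l))"
        using that by (intro sum.reindex_bij_witness[of _ "\<lambda>k. n + k - l" "\<lambda>e. e + l - n"])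
          (auto simp: g_def)
      finally show ?thesis ..
    qed
    have "0 = \<zeta> ^ n * (\<Sum>k<n. \<Sum>l<n. c k l * \<zeta> ^ k * cnj \<zeta> ^ l)"
      by (simp add: root)
    also have "\<dots> = (\<Sum>k<n. \<Sum>l<n. c k l * s ^ l * \<zeta> ^ (n + k - l))"
      unfolding sum_distrib_left
    proof (intro sum.cong refl)
      fix k l assume "k \<in> {..<n}" "l \<in> {..<n}"
      then have "n + k = l + (n + k - l)" by simp
      then have "\<zeta> ^ n * \<zeta> ^ k = \<zeta> ^ l * \<zeta> ^ (n + k - l)"
        by (metis power_add)
      then show "\<zeta> ^ n * (c k l * \<zeta> ^ k * cnj \<zeta> ^ l) = c k l * s ^ l * \<zeta> ^ (n + k - l)"
        unfolding \<open>\<zeta> * cnj \<zeta> = s\<close>[symmetric] power_mult_distrib by (simp add: algebra_simps)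
    qed
    also have "\<dots> = (\<Sum>l<n. \<Sum>k<n. c k l * s ^ l * \<zeta> ^ (n + k - l))"
      by (rule sum.swap)
    also have "\<dots> = (\<Sum>l<n. \<Sum>e<2 * n. g e l * s ^ l * \<zeta> ^ e)"
      by (intro sum.cong shift) auto
    also have "\<dots> = (\<Sum>e<2 * n. (\<Sum>l<n. g e l * s ^ l) * \<zeta> ^ e)"
      by (subst sum.swap) (simp add: sum_distrib_right)
    \<comment> \<open>Genericity of \<open>\<zeta>\<close> separates the exponents \<open>e\<close>;
      that of \<open>s\<close> then separates the indices \<open>l\<close>.\<close>
    finally have "\<forall>e<2 * n. (\<Sum>l<n. g e l * s ^ l) = 0"
      using g_D0 by (intro \<zeta>_generic D1I) auto
    then have g0: "g e l = 0" if "e < 2 * n" "l < n" for e l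
      using s_generic[of "g e"] g_D0 that by blast
    show ?thesis
    proof (intro allI impI)
      fix k l assume "k < n" "l < n"
      then show "c k l = 0"
        using g0[of "n + k - l" l] by (simp add: g_def)
    qed
  qed
  with that show ?thesis by blast
qed

text \<open>For generic \<open>\<zeta>\<close>, parallel differences have coordinate vectors
  \<open>d\<close>, \<open>e\<close> with \<open>d k * cnj (e j) = e k * cnj (d j)\<close> for all
  \<open>k\<close>, \<open>j\<close>. If two points of a line differ in coordinate \<open>l\<close>,
  that coordinate is therefore injective on the whole line.\<close>

lemma exists_generic_grid:
  fixes B :: "complex set"
  assumes "finite B" "B \<noteq> {}" "K > 0"
  obtains \<zeta> where
    "inj_on (\<lambda>b. \<Sum>k<K. b k * \<zeta> ^ k) ({..<K} \<rightarrow>\<^sub>E B)"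
    "\<And>T. T \<subseteq> (\<lambda>b. \<Sum>k<K. b k * \<zeta> ^ k) ` ({..<K} \<rightarrow>\<^sub>E B) \<Longrightarrow> collinear T \<Longrightarrow> card T \<le> card B"
proof -
  define V where "V = (\<lambda>(x, y). x - y) ` (B \<times> B)"
  \<comment> \<open>The first part serves injectivity of the evaluation, the second the parallelism
    relation.\<close>
  define D where "D = V \<union> (\<lambda>((d, e), e', d'). d * cnj e - e' * cnj d') ` ((V \<times> V) \<times> (V \<times> V))"
  have "finite V" unfolding V_def using assms(1) by auto
  then have "finite D" unfolding D_def by auto
  have VI: "x - y \<in> V" if "x \<in> B" "y \<in> B" for x y
    using that by (force simp: V_def)
  have V0: "0 \<in> V" using assms(2) VI by (metis diff_self ex_in_conv)
  have DI: "d * cnj e - e' * cnj d' \<in> D" if "d \<in> V" "e \<in> V" "e' \<in> V" "d' \<in> V" for d e e' d'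
    using that unfolding D_def by force
  obtain \<zeta> where \<zeta>: "\<And>c. (\<And>k l. k < K \<Longrightarrow> l < K \<Longrightarrow> c k l \<in> D) \<Longrightarrow>
       (\<Sum>k<K. \<Sum>l<K. c k l * \<zeta> ^ k * cnj \<zeta> ^ l) = 0 \<Longrightarrow> (\<forall>k<K. \<forall>l<K. c k l = 0)"
    using exists_hermitian_generic[OF \<open>finite D\<close>, where n = K] by blast
  define ev where "ev b = (\<Sum>k<K. b k * \<zeta> ^ k)" for b :: "nat \<Rightarrow> complex"
  define \<Lambda> where "\<Lambda> = {..<K} \<rightarrow>\<^sub>E B"
  have \<Lambda>_eqI: "b = b'" if "b \<in> \<Lambda>" "b' \<in> \<Lambda>" "\<And>k. k < K \<Longrightarrow> b k = b' k" for b b'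
    using that unfolding \<Lambda>_def by (intro PiE_ext) auto
  have \<Lambda>D: "b k \<in> B" if "b \<in> \<Lambda>" "k < K" for b k
    using that unfolding \<Lambda>_def by auto
  have ev_diff: "ev b - ev b' = (\<Sum>k<K. (b k - b' k) * \<zeta> ^ k)" for b b'
    by (simp add: ev_def algebra_simps sum_subtractf)
  have inj: "inj_on ev \<Lambda>"
  proof (rule inj_onI)
    fix b b' assume b: "b \<in> \<Lambda>" "b' \<in> \<Lambda>" "ev b = ev b'"
    \<comment> \<open>A relation in \<open>\<zeta>\<close> alone is a Hermitian relation supported
      on \<open>l = 0\<close>.\<close>
    define c where "c k l = (if l = 0 then b k - b' k else 0)" for k l :: nat
    have "(\<Sum>l<K. c k l * \<zeta> ^ k * cnj \<zeta> ^ l) = (b k - b' k) * \<zeta> ^ k" for k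
    proof -
      have "(\<Sum>l<K. c k l * \<zeta> ^ k * cnj \<zeta> ^ l) = (\<Sum>l<K. if l = 0 then (b k - b' k) * \<zeta> ^ k else 0)"
        by (intro sum.cong) (auto simp: c_def)
      then show ?thesis using assms(3) by simp
    qed
    then have "(\<Sum>k<K. \<Sum>l<K. c k l * \<zeta> ^ k * cnj \<zeta> ^ l) = 0"
      using ev_diff[of b b'] b(3) by simp
    moreover have "c k l \<in> D" if "k < K" for k l
      using \<Lambda>D[OF b(1) that] \<Lambda>D[OF b(2) that] VI V0 by (auto simp: c_def D_def)
    ultimately have "\<forall>k<K. \<forall>l<K. c k l = 0" by (intro \<zeta>) auto
    then have "c k 0 = 0" if "k < K" for k
      using that assms(3) by blast
    then have "b k = b' k" if "k < K" for k
      using that by (simp add: c_def)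
    then show "b = b'" using b \<Lambda>_eqI by blast
  qed
  have "card T \<le> card B" if T: "T \<subseteq> ev ` \<Lambda>" "collinear T" for T
  proof (cases "\<exists>x\<in>T. \<exists>y\<in>T. x \<noteq> y")
    case False
    then have "card T \<le> 1" by (metis card_le_Suc0_iff_eq One_nat_def card.infinite zero_le)
    moreover have "card B \<ge> 1" using assms(1,2) by (simp add: Suc_le_eq card_gt_0_iff)
    ultimately show ?thesis by simp
  next
    case True
    then obtain x y where xy: "x \<in> T" "y \<in> T" "x \<noteq> y" by blast
    obtain u where u: "\<And>s t. s \<in> T \<Longrightarrow> t \<in> T \<Longrightarrow> \<exists>r. s - t = r *\<^sub>R u"
      using T(2) unfolding collinear_def by blast
    define \<beta> where "\<beta> t = inv_into \<Lambda> ev t" for t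
    have \<beta>: "\<beta> t \<in> \<Lambda>" "ev (\<beta> t) = t" if "t \<in> T" for t
      using subsetD[OF T(1) that] unfolding \<beta>_def by (rule inv_into_into, rule f_inv_into_f)
    obtain l where l: "l < K" "\<beta> x l \<noteq> \<beta> y l"
      using \<Lambda>_eqI \<beta> xy by metis
    have "inj_on (\<lambda>t. \<beta> t l) T"
    proof (rule inj_onI)
      fix s t assume st: "s \<in> T" "t \<in> T" "\<beta> s l = \<beta> t l"
      define d where "d k = \<beta> s k - \<beta> t k" for k
      define e where "e k = \<beta> x k - \<beta> y k" for k
      have dV: "d k \<in> V" "e k \<in> V" if "k < K" for k
        unfolding d_def e_def using that st xy by (auto intro!: VI \<Lambda>D \<beta>)
      have d: "s - t = (\<Sum>k<K. d k * \<zeta> ^ k)" and e: "x - y = (\<Sum>k<K. e k * \<zeta> ^ k)"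
        using ev_diff[of "\<beta> s" "\<beta> t"] ev_diff[of "\<beta> x" "\<beta> y"] \<beta> st xy by (simp_all add: d_def e_def)
      obtain r r' where "s - t = r *\<^sub>R u" "x - y = r' *\<^sub>R u"
        using u st xy by meson
      then have real: "(s - t) * cnj (x - y) - (x - y) * cnj (s - t) = 0"
        by (simp add: scaleR_conv_of_real)
      \<comment> \<open>parallelism of \<open>s - t\<close> and \<open>x - y\<close> is a Hermitian relation in the powers of \<open>\<zeta>\<close>\<close>
      have "(\<Sum>k<K. \<Sum>j<K. (d k * cnj (e j) - e k * cnj (d j)) * \<zeta> ^ k * cnj \<zeta> ^ j)
          = (\<Sum>k<K. \<Sum>j<K. (d k * \<zeta> ^ k) * cnj (e j * \<zeta> ^ j) - (e k * \<zeta> ^ k) * cnj (d j * \<zeta> ^ j))"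
        by (intro sum.cong refl) (simp add: algebra_simps)
      also have "\<dots> = (s - t) * cnj (x - y) - (x - y) * cnj (s - t)"
        unfolding d e cnj_sum sum_product sum_subtractf ..
      finally have "\<forall>k<K. \<forall>j<K. d k * cnj (e j) - e k * cnj (d j) = 0"
        using real dV by (intro \<zeta> DI) auto
      \<comment> \<open>Take \<open>j = l\<close>: the second term vanishes because
        \<open>d l = 0\<close>. Since \<open>e l \<noteq> 0\<close>, all \<open>d k\<close>
        vanish.\<close>
      then have "d k * cnj (e l) = 0" if "k < K" for k
        using that l st(3) by (auto simp: d_def)
      then have "\<beta> s k = \<beta> t k" if "k < K" for k
        using that l(2) by (auto simp: d_def e_def)
      then have "\<beta> s = \<beta> t" using \<Lambda>_eqI \<beta> st by blast
      then show "s = t" using \<beta>(2) st by metis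
    qed
    moreover have "(\<lambda>t. \<beta> t l) ` T \<subseteq> B" using \<beta> \<Lambda>D l by blast
    ultimately show ?thesis using assms(1) card_inj_on_le by blast
  qed
  with inj that show ?thesis unfolding ev_def \<Lambda>_def by blast
qed

section \<open>Similar copies\<close>

text \<open>Possibly transcendental factors are pushed into \<open>w p\<close>, so that
  \<open>\<mu> p\<close> and \<open>\<nu> p\<close> can be algebraic integers. The factors
  \<open>w p\<close> only cost a union of \<open>card P\<close> dilated grids.\<close>

lemma cross_algebraic_parametrisation:
  assumes "card P \<ge> 3" "cross_algebraic P"
  obtains a b \<alpha> \<beta> and w \<mu> \<nu> :: "complex \<Rightarrow> complex" where
    "a \<in> P" "b \<in> P" "\<alpha> \<noteq> 0" "\<beta> \<noteq> 0"
    "\<And>p. p \<in> P \<Longrightarrow> w p \<noteq> 0 \<and> algebraic_int (\<mu> p) \<and> algebraic_int (\<nu> p)"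
    "\<And>i j. \<exists>y x. (\<forall>p\<in>P. y * p + x = w p * (\<mu> p * i + \<nu> p * j)) \<and> y * a + x = \<alpha> * i \<and> y * b + x = \<beta> * j"
proof -
  obtain P' where "P' \<subseteq> P" "card P' = 3"
    using assms(1) by (meson obtain_subset_with_card_n)
  then obtain a b c where abc: "a \<in> P" "b \<in> P" "c \<in> P" "a \<noteq> b" "a \<noteq> c" "b \<noteq> c"
    by (auto simp: card_3_iff)
  \<comment> \<open>The affine map with \<open>a \<mapsto> (c - a) * i\<close> and \<open>b \<mapsto> (c - b) * j\<close> sends \<open>p\<close> to a multiple of
    \<open>cross_ratio a b c p * i - j\<close>.\<close>
  define y where "y i j = ((c - a) * i - (c - b) * j) / (a - b)" for i j
  define x where "x i j = (c - a) * i - y i j * a" for i j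
  have "\<exists>w \<mu> \<nu>. w \<noteq> 0 \<and> algebraic_int \<mu> \<and> algebraic_int \<nu> \<and> (\<forall>i j. y i j * p + x i j = w * (\<mu> * i + \<nu> * j))"
    if "p \<in> P" for p
  proof (cases "p = a")
    \<comment> \<open>The denominator of the cross-ratio vanishes at \<open>p = a\<close>, where the
      image depends on \<open>i\<close> alone.\<close>
    case True
    show ?thesis
      by (rule exI[of _ "c - a"], rule exI[of _ 1], rule exI[of _ 0]) (use True abc in \<open>auto simp: x_def\<close>)
  next
    case False
    define \<rho> where "\<rho> = cross_ratio a b c p"
    have "algebraic \<rho>"
    \<comment> \<open>Cross-algebraicity covers distinct points only; the coinciding cases give the
      values 0 and 1.\<close>
    proof (cases "p = b \<or> p = c")
      case True
      then have "\<rho> = 0 \<or> \<rho> = 1" using abc by (auto simp: \<rho>_def cross_ratio_def)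
      then show ?thesis by auto
    next
      case False
      then show ?thesis
        using assms(2) abc \<open>p \<noteq> a\<close> \<open>p \<in> P\<close> by (auto simp: cross_algebraic_def \<rho>_def)
    qed
    then obtain k :: int where k: "k \<noteq> 0" "algebraic_int (of_int k * \<rho>)"
      by (rule algebraic_mult_algebraic_int)
    have "y i j * p + x i j = (p - a) * (c - b) / ((a - b) * of_int k) * ((of_int k * \<rho>) * i + (- of_int k) * j)" for i j
      using abc False k(1)
      by (simp add: y_def x_def \<rho>_def cross_ratio_def divide_simps) (simp add: algebra_simps)
    then show ?thesis
      using abc False k by (intro exI[of _ "(p - a) * (c - b) / ((a - b) * of_int k)"]
        exI[of _ "of_int k * \<rho>"] exI[of _ "- of_int k"]) auto
  qed
  then obtain w \<mu> \<nu> where w: "\<And>p. p \<in> P \<Longrightarrow> w p \<noteq> 0 \<and> algebraic_int (\<mu> p) \<and> algebraic_int (\<nu> p) \<and>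
      (\<forall>i j. y i j * p + x i j = w p * (\<mu> p * i + \<nu> p * j))"
    by metis
  have "y i j * a + x i j = (c - a) * i" "y i j * b + x i j = (c - b) * j" for i j
    using abc by (simp_all add: y_def x_def divide_simps) (simp add: algebra_simps)
  then have "\<exists>y x. (\<forall>p\<in>P. y * p + x = w p * (\<mu> p * i + \<nu> p * j)) \<and>
      y * a + x = (c - a) * i \<and> y * b + x = (c - b) * j" for i j
    using w by (intro exI[of _ "y i j"] exI[of _ "x i j"]) blast
  then show ?thesis
    using w abc by (intro that[of a b "c - a" "c - b" w \<mu> \<nu>]) auto
qed

text \<open>A copy together with its images of \<open>a\<close> and \<open>b\<close> determines
  \<open>(i, j)\<close>, so each copy arises from at most \<open>(card P)\<^sup>2\<close> pairs. The
  pairs with \<open>\<alpha> * i = \<beta> * j\<close>, whose map is constant when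
  \<open>a \<noteq> b\<close>, number at most \<open>card \<Lambda>\<close>.\<close>

lemma card_grid_le_num_similar_copies:
  fixes \<Lambda> P Q :: "complex set"
  assumes "finite Q" "finite \<Lambda>" "finite P" "a \<in> P" "b \<in> P" "\<alpha> \<noteq> 0" "\<beta> \<noteq> 0"
    and copy: "\<And>i j. i \<in> \<Lambda> \<Longrightarrow> j \<in> \<Lambda> \<Longrightarrow>
      \<exists>y x. (\<forall>p\<in>P. y * p + x \<in> Q) \<and> y * a + x = \<alpha> * i \<and> y * b + x = \<beta> * j"
  shows "(card \<Lambda>)\<^sup>2 \<le> num_similar_copies P Q * (card P)\<^sup>2 + card \<Lambda>"
proof -
  define R where "R = {(i, j) \<in> \<Lambda> \<times> \<Lambda>. \<alpha> * i \<noteq> \<beta> * j}"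
  define Z where "Z = {(i, j) \<in> \<Lambda> \<times> \<Lambda>. \<alpha> * i = \<beta> * j}"
  define \<T> where "\<T> = {T. T \<subseteq> Q \<and> similar_sets P T}"
  have "finite \<T>"
    unfolding \<T>_def using assms(1) by simp
  have card_T: "card T = card P" "finite T" if "T \<in> \<T>" for T
  proof -
    have "similar_sets P T" using that by (simp add: \<T>_def)
    then obtain y x where "y \<noteq> 0" "T = (\<lambda>a. y * a + x) ` P"
      unfolding similar_sets_def by blast
    then show "card T = card P" "finite T"
      using assms(3) by (auto intro!: card_image simp: inj_on_def)
  qed
  have "R \<subseteq> (\<lambda>(T, s, t). (s / \<alpha>, t / \<beta>)) ` (SIGMA T:\<T>. T \<times> T)"
  proof safe
    fix i j assume "(i, j) \<in> R"
    then have ij: "i \<in> \<Lambda>" "j \<in> \<Lambda>" "\<alpha> * i \<noteq> \<beta> * j" by (auto simp: R_def)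
    obtain y x where yx: "\<forall>p\<in>P. y * p + x \<in> Q" "y * a + x = \<alpha> * i" "y * b + x = \<beta> * j"
      using copy[OF ij(1,2)] by blast
    have "y \<noteq> 0" using yx ij(3) by auto
    then have "(\<lambda>p. y * p + x) ` P \<in> \<T>"
      using yx(1) by (auto simp: \<T>_def similar_sets_def)
    moreover have "\<alpha> * i \<in> (\<lambda>p. y * p + x) ` P" "\<beta> * j \<in> (\<lambda>p. y * p + x) ` P"
      using yx assms(4,5) by (auto simp: image_iff intro: bexI[of _ a] bexI[of _ b])
    ultimately show "(i, j) \<in> (\<lambda>(T, s, t). (s / \<alpha>, t / \<beta>)) ` (SIGMA T:\<T>. T \<times> T)"
      using assms(6,7)
      by (intro image_eqI[of _ _ "((\<lambda>p. y * p + x) ` P, \<alpha> * i, \<beta> * j)"]) auto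
  qed
  then have "card R \<le> card (SIGMA T:\<T>. T \<times> T)"
    using \<open>finite \<T>\<close> card_T by (intro surj_card_le[rotated]) auto
  also have "\<dots> = (\<Sum>T\<in>\<T>. card (T \<times> T))"
    using \<open>finite \<T>\<close> card_T by (intro card_SigmaI) auto
  also have "\<dots> = num_similar_copies P Q * (card P)\<^sup>2"
    using card_T by (simp add: card_cartesian_product num_similar_copies_def \<T>_def power2_eq_square)
  finally have "card R \<le> num_similar_copies P Q * (card P)\<^sup>2" .
  moreover have "card Z \<le> card \<Lambda>"
    using assms(2,7) by (intro card_inj_on_le[of fst]) (auto simp: Z_def inj_on_def)
  moreover have "card R + card Z = card (\<Lambda> \<times> \<Lambda>)"
  proof -
    have "\<Lambda> \<times> \<Lambda> = R \<union> Z" "R \<inter> Z = {}" by (auto simp: R_def Z_def)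
    moreover from this have "finite R" "finite Z"
      using assms(2) by (metis finite_Un finite_cartesian_product)+
    ultimately show ?thesis by (simp add: card_Un_disjoint)
  qed
  ultimately show ?thesis
    by (simp add: card_cartesian_product power2_eq_square)
qed

lemma lattice_box_linear_combinations:
  assumes "finite E" "finite P" and stable: "\<And>s e. s \<in> \<mu> ` P \<union> \<nu> ` P \<Longrightarrow> e \<in> E \<Longrightarrow> s * e \<in> int_module.span E"
  obtains C where "C > 0"
    "\<And>p N x y. p \<in> P \<Longrightarrow> x \<in> lattice_box E N \<Longrightarrow> y \<in> lattice_box E N \<Longrightarrow>
       \<mu> p * x + \<nu> p * y \<in> lattice_box E (C * N)"
proof -
  define S where "S = \<mu> ` P \<union> \<nu> ` P"
  have "finite S" using assms(2) by (simp add: S_def)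
  have "\<exists>C. \<forall>N. \<forall>y\<in>lattice_box E N. s * y \<in> lattice_box E (C * N)" if "s \<in> S" for s
    using lattice_box_mult[OF assms(1) stable] that unfolding S_def by metis
  then obtain c where c: "\<And>s N y. s \<in> S \<Longrightarrow> y \<in> lattice_box E N \<Longrightarrow> s * y \<in> lattice_box E (c s * N)"
    by metis
  define C where "C = (\<Sum>s\<in>S. c s)"
  have C: "s * y \<in> lattice_box E (C * N)" if "s \<in> S" "y \<in> lattice_box E N" for s N y
  proof -
    have "c s \<le> C" unfolding C_def using that(1) \<open>finite S\<close> by (intro member_le_sum) auto
    then have "c s * N \<le> C * N" by simp
    then show ?thesis using c[OF that] lattice_box_mono by blast
  qed
  \<comment> \<open>Two summands give \<open>2 * C\<close>; the extra 1 makes the constant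
    positive.\<close>
  have "\<mu> p * x + \<nu> p * y \<in> lattice_box E ((2 * C + 1) * N)"
    if "p \<in> P" "x \<in> lattice_box E N" "y \<in> lattice_box E N" for p N x y
  proof -
    have "\<mu> p * x + \<nu> p * y \<in> lattice_box E (C * N + C * N)"
      using that by (intro lattice_box_add C) (auto simp: S_def)
    moreover have "C * N + C * N \<le> (2 * C + 1) * N" by (simp add: algebra_simps)
    ultimately show ?thesis using lattice_box_mono by blast
  qed
  then show ?thesis by (intro that[of "2 * C + 1"]) auto
qed

text \<open>\<open>q N\<close> is the size of the box of radius \<open>N\<close>. Both
  \<open>C\<close> and \<open>q\<close> depend on \<open>P\<close> only, so they may be fixed before
  \<open>K\<close> and \<open>N\<close>.\<close>

lemma exists_rich_configurations:
  assumes "finite P" "card P \<ge> 3" "cross_algebraic P"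
  obtains C :: nat and q :: "nat \<Rightarrow> nat" where
    "C > 0" "mono q" "\<And>N. N < q N" "\<And>A N. N > 0 \<Longrightarrow> q (A * N) \<le> q A * q N"
    "\<And>K N. K > 0 \<Longrightarrow> \<exists>Q. finite Q \<and> card Q \<le> card P * q (C * N) ^ K \<and>
       (\<forall>T\<subseteq>Q. collinear T \<longrightarrow> card T \<le> card P * q (C * N)) \<and>
       (q N ^ K)\<^sup>2 \<le> num_similar_copies P Q * (card P)\<^sup>2 + q N ^ K"
proof -
  obtain a b \<alpha> \<beta> and w \<mu> \<nu> :: "complex \<Rightarrow> complex" where ab: "a \<in> P" "b \<in> P" "\<alpha> \<noteq> 0" "\<beta> \<noteq> 0"
    and w: "\<And>p. p \<in> P \<Longrightarrow> w p \<noteq> 0 \<and> algebraic_int (\<mu> p) \<and> algebraic_int (\<nu> p)"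
    and param: "\<And>i j. \<exists>y x. (\<forall>p\<in>P. y * p + x = w p * (\<mu> p * i + \<nu> p * j)) \<and> y * a + x = \<alpha> * i \<and> y * b + x = \<beta> * j"
    using cross_algebraic_parametrisation[OF assms(2,3)] by blast
  have "finite (\<mu> ` P \<union> \<nu> ` P)" using assms(1) by simp
  then obtain E where E: "finite E" "1 \<in> E"
      "\<And>s e. s \<in> \<mu> ` P \<union> \<nu> ` P \<Longrightarrow> e \<in> E \<Longrightarrow> s * e \<in> int_module.span E"
    using algebraic_ints_stabilise_lattice[of "\<mu> ` P \<union> \<nu> ` P"] w by blast
  obtain C where C: "C > 0" "\<And>p N x y. p \<in> P \<Longrightarrow> x \<in> lattice_box E N \<Longrightarrow> y \<in> lattice_box E N \<Longrightarrow>
       \<mu> p * x + \<nu> p * y \<in> lattice_box E (C * N)"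
    using lattice_box_linear_combinations[OF E(1) assms(1) E(3)] by blast
  define q where "q N = card (lattice_box E N)" for N
  have q_mono: "mono q"
    unfolding q_def by (intro monoI card_mono finite_lattice_box E(1) lattice_box_mono)
  have q_gt: "N < q N" for N
    unfolding q_def using card_lattice_box_gt[OF E(1,2)] .
  have q_mult: "q (A * N) \<le> q A * q N" if "N > 0" for A N
    unfolding q_def using card_lattice_box_mult_le[OF E(1) that] .
  have config: "\<exists>Q. finite Q \<and> card Q \<le> card P * q (C * N) ^ K \<and>
       (\<forall>T\<subseteq>Q. collinear T \<longrightarrow> card T \<le> card P * q (C * N)) \<and>
       (q N ^ K)\<^sup>2 \<le> num_similar_copies P Q * (card P)\<^sup>2 + q N ^ K" if "K > 0" for K N
  proof -
    \<comment> \<open>The radius \<open>C * N\<close> makes room for all combinations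
      \<open>\<mu> p * x + \<nu> p * y\<close> of elements of the box of radius
      \<open>N\<close>.\<close>
    define B where "B = lattice_box E (C * N)"
    have B: "finite B" "B \<noteq> {}"
      using finite_lattice_box[OF E(1)] zero_in_lattice_box unfolding B_def by blast+
    have sub: "lattice_box E N \<subseteq> B"
      unfolding B_def using C(1) by (intro lattice_box_mono) simp
    obtain \<zeta> where inj: "inj_on (\<lambda>b. \<Sum>k<K. b k * \<zeta> ^ k) ({..<K} \<rightarrow>\<^sub>E B)"
      and lines: "\<And>T. T \<subseteq> (\<lambda>b. \<Sum>k<K. b k * \<zeta> ^ k) ` ({..<K} \<rightarrow>\<^sub>E B) \<Longrightarrow> collinear T \<Longrightarrow> card T \<le> card B"
      using exists_generic_grid[OF B \<open>K > 0\<close>] by blast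
    define ev where "ev b = (\<Sum>k<K. b k * \<zeta> ^ k)" for b :: "nat \<Rightarrow> complex"
    define G where "G = ev ` ({..<K} \<rightarrow>\<^sub>E B)"
    define \<Lambda> where "\<Lambda> = ev ` ({..<K} \<rightarrow>\<^sub>E lattice_box E N)"
    define Q where "Q = (\<Union>p\<in>P. (\<lambda>g. w p * g) ` G)"
    have "finite G" "finite \<Lambda>"
      unfolding G_def \<Lambda>_def using B(1) finite_lattice_box[OF E(1)] by (auto intro!: finite_PiE)
    have "card \<Lambda> = q N ^ K"
    proof -
      have "inj_on ev ({..<K} \<rightarrow>\<^sub>E lattice_box E N)"
        using inj PiE_mono[of "{..<K}" "\<lambda>_. lattice_box E N" "\<lambda>_. B"] sub
        unfolding ev_def by (intro inj_on_subset[OF inj]) auto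
      then show ?thesis by (simp add: \<Lambda>_def card_image card_funcsetE q_def)
    qed
    have "card G = q (C * N) ^ K"
      using inj by (simp add: G_def ev_def card_image card_funcsetE q_def B_def)
    have "card Q \<le> (\<Sum>p\<in>P. card ((\<lambda>g. w p * g) ` G))"
      unfolding Q_def using assms(1) by (rule card_UN_le)
    also have "\<dots> \<le> (\<Sum>p\<in>P. card G)"
      using \<open>finite G\<close> by (intro sum_mono card_image_le)
    finally have card_Q: "card Q \<le> card P * q (C * N) ^ K"
      using \<open>card G = q (C * N) ^ K\<close> by simp
    have Q_lines: "card T \<le> card P * q (C * N)" if "T \<subseteq> Q" "collinear T" for T
    proof -
      \<comment> \<open>Undoing the dilation by \<open>w p\<close> keeps points collinear, so
        \<open>T\<close> splits into \<open>card P\<close> pieces to which the bound for the grid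
        applies.\<close>
      define U where "U p = {g \<in> G. w p * g \<in> T}" for p
      have "collinear (U p)" if "p \<in> P" for p
      proof -
        obtain u where u: "\<And>s t. s \<in> T \<Longrightarrow> t \<in> T \<Longrightarrow> \<exists>r. s - t = r *\<^sub>R u"
          using \<open>collinear T\<close> unfolding collinear_def by blast
        have "\<exists>r. s - t = r *\<^sub>R (u / w p)" if "s \<in> U p" "t \<in> U p" for s t
        proof -
          obtain r where "w p * s - w p * t = r *\<^sub>R u"
            using u \<open>s \<in> U p\<close> \<open>t \<in> U p\<close> by (auto simp: U_def)
          then have "s - t = r *\<^sub>R (u / w p)"
            using w[OF \<open>p \<in> P\<close>] by (simp add: field_simps scaleR_conv_of_real)
          then show ?thesis ..
        qed
        then show ?thesis unfolding collinear_def by blast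
      qed
      then have card_U: "card (U p) \<le> q (C * N)" if "p \<in> P" for p
        using lines[of "U p"] that by (auto simp: U_def G_def ev_def q_def B_def)
      have "T \<subseteq> (\<Union>p\<in>P. (\<lambda>g. w p * g) ` U p)"
      proof
        fix t assume "t \<in> T"
        then obtain p g where "p \<in> P" "g \<in> G" "t = w p * g"
          using \<open>T \<subseteq> Q\<close> by (auto simp: Q_def)
        then show "t \<in> (\<Union>p\<in>P. (\<lambda>g. w p * g) ` U p)"
          using \<open>t \<in> T\<close> by (auto simp: U_def)
      qed
      then have "card T \<le> card (\<Union>p\<in>P. (\<lambda>g. w p * g) ` U p)"
        using assms(1) \<open>finite G\<close> by (intro card_mono) (auto simp: U_def)
      also have "\<dots> \<le> (\<Sum>p\<in>P. card ((\<lambda>g. w p * g) ` U p))"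
        using assms(1) by (rule card_UN_le)
      also have "\<dots> \<le> (\<Sum>p\<in>P. q (C * N))"
        using card_U \<open>finite G\<close>
        by (intro sum_mono order_trans[OF card_image_le]) (auto simp: U_def)
      finally show ?thesis by simp
    qed
    have "(card \<Lambda>)\<^sup>2 \<le> num_similar_copies P Q * (card P)\<^sup>2 + card \<Lambda>"
    proof (rule card_grid_le_num_similar_copies[OF _ \<open>finite \<Lambda>\<close> assms(1) ab])
      show "finite Q" using assms(1) \<open>finite G\<close> by (simp add: Q_def)
      fix i j assume "i \<in> \<Lambda>" "j \<in> \<Lambda>"
      then obtain f g where f: "f \<in> {..<K} \<rightarrow>\<^sub>E lattice_box E N" "i = ev f"
        and g: "g \<in> {..<K} \<rightarrow>\<^sub>E lattice_box E N" "j = ev g"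
        by (auto simp: \<Lambda>_def)
      have "\<mu> p * i + \<nu> p * j \<in> G" if "p \<in> P" for p
      proof -
        \<comment> \<open>Evaluation at \<open>\<zeta>\<close> is linear, so the combination can be
          formed coordinatewise.\<close>
        define h where "h = (\<lambda>k\<in>{..<K}. \<mu> p * f k + \<nu> p * g k)"
        have "h \<in> {..<K} \<rightarrow>\<^sub>E B"
          unfolding h_def B_def restrict_PiE_iff
          using PiE_mem[OF f(1)] PiE_mem[OF g(1)] C(2)[OF that] by blast
        moreover have "\<mu> p * i + \<nu> p * j = ev h"
          by (simp add: f(2) g(2) ev_def h_def sum_distrib_left algebra_simps sum.distrib)
        ultimately show ?thesis by (simp add: G_def)
      qed
      then have "w p * (\<mu> p * i + \<nu> p * j) \<in> Q" if "p \<in> P" for p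
        using that by (auto simp: Q_def)
      moreover obtain y x where "\<forall>p\<in>P. y * p + x = w p * (\<mu> p * i + \<nu> p * j)"
          "y * a + x = \<alpha> * i" "y * b + x = \<beta> * j"
        using param[of i j] by blast
      ultimately show "\<exists>y x. (\<forall>p\<in>P. y * p + x \<in> Q) \<and> y * a + x = \<alpha> * i \<and> y * b + x = \<beta> * j"
        by (intro exI[of _ y] exI[of _ x]) simp
    qed
    then show ?thesis
      using \<open>card \<Lambda> = q N ^ K\<close> card_Q Q_lines assms(1) \<open>finite G\<close>
      by (intro exI[of _ Q]) (auto simp: Q_def)
  qed
  show ?thesis by (rule that[of C q, OF C(1) q_mono q_gt q_mult config])
qed

section \<open>Prescribing the number of points\<close>

text \<open>Finitely many points and lines form a null set of the plane.\<close>

lemma exists_point_off_lines: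
  fixes Q :: "complex set"
  assumes "finite Q"
  obtains z where "z \<notin> Q" "\<And>a b. a \<in> Q \<Longrightarrow> b \<in> Q \<Longrightarrow> a \<noteq> b \<Longrightarrow> \<not> collinear {a, b, z}"
proof -
  have "negligible (affine hull {a, b})" for a b :: complex
    by (simp add: negligible_convex_interior affine_imp_convex empty_interior_affine_hull card_insert_if)
  then have "negligible (\<Union>(a, b)\<in>Q \<times> Q. affine hull {a, b})"
    using assms by (intro negligible_Union) auto
  then have "negligible (Q \<union> (\<Union>(a, b)\<in>Q \<times> Q. affine hull {a, b}))"
    using assms by (simp add: negligible_Un negligible_finite)
  then obtain z where "z \<notin> Q \<union> (\<Union>(a, b)\<in>Q \<times> Q. affine hull {a, b})"
    using non_negligible_UNIV by (metis UNIV_eq_I)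
  then show ?thesis
    using that[of z] collinear_3_imp_in_affine_hull by blast
qed

text \<open>Points are added off all lines spanned so far. As \<open>m \<ge> 3\<close>, a collinear
  \<open>m\<close>-set through the new point would contain two old points and put it on their
  line.\<close>

lemma extend_no_collinear:
  assumes "finite Q" "no_collinear m Q" "m \<ge> 3" "card Q \<le> n"
  obtains Q' where "Q \<subseteq> Q'" "finite Q'" "card Q' = n" "no_collinear m Q'"
proof -
  have "\<exists>Q'. Q \<subseteq> Q' \<and> finite Q' \<and> card Q' = n \<and> no_collinear m Q'"
    using assms(4)
  proof (induction rule: dec_induct)
    case base
    show ?case using assms by blast
  next
    case (step n)
    then obtain Q' where Q': "Q \<subseteq> Q'" "finite Q'" "card Q' = n" "no_collinear m Q'"
      by blast
    obtain z where z: "z \<notin> Q'" "\<And>a b. a \<in> Q' \<Longrightarrow> b \<in> Q' \<Longrightarrow> a \<noteq> b \<Longrightarrow> \<not> collinear {a, b, z}"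
      using exists_point_off_lines[OF Q'(2)] by blast
    have "\<not> collinear T" if T: "T \<subseteq> insert z Q'" "card T = m" for T
    proof
      assume "collinear T"
      show False
      proof (cases "z \<in> T")
        case False
        then have "T \<subseteq> Q'" using T by blast
        then show False using Q'(4) T(2) \<open>collinear T\<close> by (auto simp: no_collinear_def)
      next
        case True
        have "card (T - {z}) \<ge> 2" using True T(2) assms(3)
          by simp
        then obtain U where "U \<subseteq> T - {z}" "card U = 2"
          by (meson obtain_subset_with_card_n)
        then obtain a b where "a \<in> T - {z}" "b \<in> T - {z}" "a \<noteq> b"
          by (auto simp: card_2_iff)
        then have "\<not> collinear {a, b, z}" using z(2) T(1) by blast
        moreover have "{a, b, z} \<subseteq> T" using True \<open>a \<in> T - {z}\<close> \<open>b \<in> T - {z}\<close> by blast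
        ultimately show False using \<open>collinear T\<close> collinear_subset by blast
      qed
    qed
    then have "no_collinear m (insert z Q')" by (auto simp: no_collinear_def)
    then show ?case
      using Q' z(1) by (intro exI[of _ "insert z Q'"]) auto
  qed
  with that show ?thesis by blast
qed

lemma num_similar_copies_mono:
  assumes "finite Q'" "Q \<subseteq> Q'"
  shows "num_similar_copies P Q \<le> num_similar_copies P Q'"
  unfolding num_similar_copies_def
proof (rule card_mono)
  show "finite {T. T \<subseteq> Q' \<and> similar_sets P T}"
    using assms(1) by (rule finite_subset[rotated, OF finite_Pow_iff[THEN iffD2]]) auto
qed (use assms(2) in blast)

text \<open>Adding points destroys no copy, so a construction with at most \<open>n\<close> points
  suffices. The bound \<open>2 ^ n\<close> makes the set under \<open>Max\<close> finite.\<close>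

lemma max_similar_copies_ge:
  assumes "finite Q" "no_collinear m Q" "m \<ge> 3" "card Q \<le> n"
  shows "num_similar_copies P Q \<le> max_similar_copies P n m"
proof -
  obtain Q' where Q': "Q \<subseteq> Q'" "finite Q'" "card Q' = n" "no_collinear m Q'"
    using extend_no_collinear[OF assms] by blast
  define V where "V = {num_similar_copies P Q | Q. finite Q \<and> card Q = n \<and> no_collinear m Q}"
  have "num_similar_copies P R \<le> 2 ^ card R" if "finite R" for R
  proof -
    have "num_similar_copies P R \<le> card (Pow R)"
      unfolding num_similar_copies_def using that by (intro card_mono) auto
    then show ?thesis using that by (simp add: card_Pow)
  qed
  then have "V \<subseteq> {..2 ^ n}" by (auto simp: V_def)
  then have "finite V" using finite_subset by blast
  moreover have "num_similar_copies P Q' \<in> V" using Q' by (auto simp: V_def)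
  ultimately have "num_similar_copies P Q' \<le> Max V" by (rule Max_ge)
  then show ?thesis
    using num_similar_copies_mono[OF Q'(2,1), of P] by (simp add: max_similar_copies_def V_def)
qed

text \<open>At most two points are always collinear.\<close>

lemma no_collinear_ge_3:
  assumes "card P \<ge> 2" "no_collinear m P"
  shows "m \<ge> 3"
proof (rule ccontr)
  assume "\<not> m \<ge> 3"
  then have "m \<le> card P" "m = 0 \<or> m = 1 \<or> m = 2" using assms(1) by linarith+
  then obtain T where T: "T \<subseteq> P" "card T = m" "finite T"
    by (meson obtain_subset_with_card_n)
  then have "collinear T"
    using \<open>m = 0 \<or> m = 1 \<or> m = 2\<close> by (auto simp: card_1_singleton_iff card_2_iff)
  then show False using T assms(2) by (auto simp: no_collinear_def)
qed

section \<open>Choice of the scale and the quadratic bound\<close>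

lemma exists_scale:
  fixes q :: "nat \<Rightarrow> nat"
  assumes "C > 0" "\<And>N. N < q N" "M > 0" "K > 0" "M * q C ^ K \<le> n"
  obtains N where "N > 0" "M * q (C * N) ^ K \<le> n" "n < M * q (C * (N + 1)) ^ K"
proof -
  have "n < M * q (C * (n + 1)) ^ K"
  proof -
    have "n \<le> C * (n + 1)" using assms(1) by (cases C) auto
    also have "\<dots> < q (C * (n + 1))" by (rule assms(2))
    also have "\<dots> \<le> q (C * (n + 1)) ^ K"
      using assms(2)[of "C * (n + 1)"] assms(4) by (intro self_le_power) auto
    also have "\<dots> \<le> M * q (C * (n + 1)) ^ K" using assms(3) by simp
    finally show ?thesis .
  qed
  \<comment> \<open>The least such \<open>N\<close> is positive because 0 fails by hypothesis, and
    failure at \<open>N - 1\<close> is the lower estimate.\<close>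
  then obtain N where N: "n < M * q (C * (N + 1)) ^ K" "\<And>N'. N' < N \<Longrightarrow> \<not> n < M * q (C * (N' + 1)) ^ K"
    using exists_least_iff[THEN iffD1, OF exI[of "\<lambda>N. n < M * q (C * (N + 1)) ^ K" n]] by blast
  have "N > 0" using N(1) assms(5) by (cases N) auto
  moreover have "M * q (C * N) ^ K \<le> n"
    using N(2)[of "N - 1"] \<open>N > 0\<close> by simp
  ultimately show ?thesis using that N(1) by blast
qed

theorem theorem8:
  fixes P :: "complex set" and \<alpha> :: real
  assumes "finite P" and "card P \<ge> 3" and "cross_algebraic P"
    and "0 < \<alpha>" and "\<alpha> < 1"
  shows "\<exists>c\<^sub>1>0. \<forall>m :: nat \<Rightarrow> nat.
           (\<forall>n\<ge>card P. real (m n) \<ge> real n powr \<alpha>) \<longrightarrow>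
           (\<forall>n\<ge>card P. no_collinear (m n) P \<longrightarrow>
              real (max_similar_copies P n (m n)) \<ge> c\<^sub>1 * (real n)\<^sup>2)"
proof -
  obtain C :: nat and q :: "nat \<Rightarrow> nat" where q: "C > 0" "mono q" "\<And>N. N < q N"
    "\<And>A N. N > 0 \<Longrightarrow> q (A * N) \<le> q A * q N"
    and config: "\<And>K N. K > 0 \<Longrightarrow> \<exists>Q. finite Q \<and> card Q \<le> card P * q (C * N) ^ K \<and>
       (\<forall>T\<subseteq>Q. collinear T \<longrightarrow> card T \<le> card P * q (C * N)) \<and>
       (q N ^ K)\<^sup>2 \<le> num_similar_copies P Q * (card P)\<^sup>2 + q N ^ K"
  proof (rule exists_rich_configurations[OF assms(1-3)], goal_cases)
    case (1 C q)
    show ?case by (rule 1(1)[of C q, OF 1(2-6)])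
  qed
  define M where "M = card P"
  have "M \<ge> 3" using assms(2) by (simp add: M_def)
  obtain K :: nat where K: "real K * \<alpha> \<ge> 2" "K > 0"
  proof -
    obtain K :: nat where "real K > 2 / \<alpha>" using reals_Archimedean2 by blast
    then have "real K * \<alpha> > 2" using assms(4) by (simp add: field_simps)
    then show ?thesis using that[of K] by (cases K) auto
  qed
  \<comment> \<open>The first summand allows a scale \<open>N > 0\<close> to be chosen, the second
    beats the factor \<open>M ^ K\<close> in the count on lines, and 1 makes the comparison
    strict.\<close>
  define n0 where "n0 = M * q C ^ K + M ^ K + 1"
  define G where "G = q (2 * C) ^ K"
  have "G > 0" using q(3)[of "2 * C"] by (simp add: G_def)
  \<comment> \<open>The first entry serves \<open>n < n0\<close>, where the single copy
    \<open>P\<close> is enough; the second comes from the final chain of estimates.\<close>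
  define c where "c = min (1 / (real n0)\<^sup>2) (1 / (2 * real M ^ 4 * (real G)\<^sup>2))"
  have "n0 > 0" by (simp add: n0_def)
  then have "c > 0" using \<open>G > 0\<close> \<open>M \<ge> 3\<close> by (simp add: c_def)
  moreover have "real (max_similar_copies P n (m n)) \<ge> c * (real n)\<^sup>2"
    if m: "\<forall>n\<ge>card P. real (m n) \<ge> real n powr \<alpha>" and n: "n \<ge> card P" and P: "no_collinear (m n) P"
    for m :: "nat \<Rightarrow> nat" and n
  proof -
    have "m n \<ge> 3" using no_collinear_ge_3[OF _ P] assms(2) by linarith
    show ?thesis
    proof (cases "n < n0")
      case True
      have "num_similar_copies P P \<ge> 1"
      proof -
        have "similar_sets P P"
          unfolding similar_sets_def by (intro exI[of _ 1] exI[of _ 0]) simp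
        then have "{P} \<subseteq> {T. T \<subseteq> P \<and> similar_sets P T}" by simp
        then have "card {P} \<le> card {T. T \<subseteq> P \<and> similar_sets P T}"
          using assms(1) by (intro card_mono) auto
        then show ?thesis by (simp add: num_similar_copies_def)
      qed
      then have "max_similar_copies P n (m n) \<ge> 1"
        using max_similar_copies_ge[OF assms(1) P \<open>m n \<ge> 3\<close> n, of P] by simp
      moreover have "c * (real n)\<^sup>2 \<le> 1"
      proof -
        have "c * (real n)\<^sup>2 \<le> 1 / (real n0)\<^sup>2 * (real n0)\<^sup>2"
          using True \<open>c > 0\<close> by (intro mult_mono power_mono) (auto simp: c_def)
        then show ?thesis using \<open>n0 > 0\<close> by simp
      qed
      ultimately show ?thesis by linarith
    next
      case False
      then have "M * q C ^ K \<le> n" "M ^ K < n" by (simp_all add: n0_def)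
      then obtain N where N: "N > 0" "M * q (C * N) ^ K \<le> n" "n < M * q (C * (N + 1)) ^ K"
        using exists_scale[of C q M K n] q K(2) \<open>M \<ge> 3\<close> by auto
      obtain Q where Q: "finite Q" "card Q \<le> M * q (C * N) ^ K"
        "\<And>T. T \<subseteq> Q \<Longrightarrow> collinear T \<Longrightarrow> card T \<le> M * q (C * N)"
        "(q N ^ K)\<^sup>2 \<le> num_similar_copies P Q * M\<^sup>2 + q N ^ K"
        using config[OF K(2), of N] unfolding M_def by blast
      \<comment> \<open>Otherwise raising \<open>n powr \<alpha>\<close> to the power
        \<open>K\<close> gives \<open>n\<^sup>2 \<le> M ^ K * n\<close>, against
        \<open>M ^ K < n\<close>.\<close>
      have "M * q (C * N) < m n"
      proof (rule ccontr)
        assume "\<not> M * q (C * N) < m n"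
        then have "real n powr \<alpha> \<le> real (M * q (C * N))"
          using m n by (meson le_trans not_le of_nat_le_iff order_trans)
        then have "(real n powr \<alpha>) ^ K \<le> real (M * q (C * N)) ^ K"
          by (intro power_mono) auto
        moreover have "(real n powr \<alpha>) ^ K = real n powr (real K * \<alpha>)"
          using \<open>M ^ K < n\<close> by (simp add: powr_powr mult.commute flip: powr_realpow)
        moreover have "(real n)\<^sup>2 \<le> real n powr (real K * \<alpha>)"
          using K(1) \<open>M ^ K < n\<close> powr_mono[of 2 "real K * \<alpha>" "real n"] by (simp add: powr_numeral)
        ultimately have "(real n)\<^sup>2 \<le> real ((M * q (C * N)) ^ K)" by simp
        then have "n\<^sup>2 \<le> (M * q (C * N)) ^ K"
          by (metis of_nat_le_iff of_nat_power)
        also have "\<dots> \<le> M ^ K * (M * q (C * N) ^ K)"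
          using \<open>M \<ge> 3\<close> by (simp add: power_mult_distrib)
        also have "\<dots> \<le> M ^ K * n" using N(2) by (rule mult_le_mono2)
        finally have "n \<le> M ^ K" using \<open>M ^ K < n\<close> by (simp add: power2_eq_square)
        then show False using \<open>M ^ K < n\<close> by simp
      qed
      then have "no_collinear (m n) Q"
        using Q(3) unfolding no_collinear_def by (metis not_le)
      then have "num_similar_copies P Q \<le> max_similar_copies P n (m n)"
        using Q(1,2) N(2) \<open>m n \<ge> 3\<close> by (intro max_similar_copies_ge) auto
      moreover have "c * (real n)\<^sup>2 \<le> real (num_similar_copies P Q)"
      proof -
        define X where "X = q N ^ K"
        have "q N \<ge> 2" using q(3)[of N] N(1) by linarith
        also have "q N \<le> X" unfolding X_def using \<open>q N \<ge> 2\<close> K(2) by (intro self_le_power) auto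
        \<comment> \<open>As \<open>X \<ge> 2\<close>, the linear loss from degenerate pairs is at
          most half of \<open>X\<^sup>2\<close>.\<close>
        finally have "X * 2 \<le> X\<^sup>2" by (simp add: power2_eq_square)
        then have X: "X\<^sup>2 \<le> 2 * (num_similar_copies P Q * M\<^sup>2)"
          using Q(4) unfolding X_def by linarith
        \<comment> \<open>\<open>N \<ge> 1\<close> gives \<open>C * (N + 1) \<le> 2 * C * N\<close>,
          so passing to the next scale costs only the constant factor \<open>G\<close>.\<close>
        have "q (C * (N + 1)) \<le> q (2 * C * N)"
          using N(1) by (intro monoD[OF q(2)]) (cases N, auto)
        also have "\<dots> \<le> q (2 * C) * q N" using q(4) N(1) by simp
        finally have "q (C * (N + 1)) ^ K \<le> G * X"
          unfolding G_def X_def power_mult_distrib[symmetric] by (intro power_mono) auto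
        then have "n \<le> M * (G * X)"
          using N(3) by (meson le_trans less_imp_le mult_le_mono2)
        then have "n\<^sup>2 \<le> (M * (G * X))\<^sup>2" by (rule power_mono) simp
        also have "\<dots> = M\<^sup>2 * G\<^sup>2 * X\<^sup>2" by (simp add: power_mult_distrib)
        also have "\<dots> \<le> M\<^sup>2 * G\<^sup>2 * (2 * (num_similar_copies P Q * M\<^sup>2))"
          using X by (rule mult_le_mono2)
        also have "\<dots> = 2 * M ^ 4 * G\<^sup>2 * num_similar_copies P Q"
          by (simp add: power2_eq_square power4_eq_xxxx)
        finally have "real (n\<^sup>2) \<le> real (2 * M ^ 4 * G\<^sup>2 * num_similar_copies P Q)"
          by (rule of_nat_mono)
        then have "(real n)\<^sup>2 / (2 * real M ^ 4 * (real G)\<^sup>2) \<le> real (num_similar_copies P Q)"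
          using \<open>M \<ge> 3\<close> \<open>G > 0\<close> by (simp add: field_simps)
        moreover have "c * (real n)\<^sup>2 \<le> 1 / (2 * real M ^ 4 * (real G)\<^sup>2) * (real n)\<^sup>2"
          by (intro mult_right_mono) (auto simp: c_def)
        ultimately show ?thesis by simp
      qed
      ultimately show ?thesis by linarith
    qed
  qed
  ultimately show ?thesis by blast
qed

end
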